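(* Let $(\mathbf A_{\mathrm{GARK}},\mathbf b_{\mathrm{GARK}})$ be a GARK scheme with $N$ partitions that is symplectic and has palindromic weights, $\mathbf b^{\{m\}}=\mathcal P^{\{m\}}\mathbf b^{\{m\}}=\underline{\mathbf b}^{\{m\}}$ for all $m=1,\dots,N$. The scheme obtained by applying one step of the GARK scheme, followed by one step (of the same step size) of its time-reversed GARK scheme $(\underline{\mathbf A}_{\mathrm{GARK}},\underline{\mathbf b}_{\mathrm{GARK}})$, is the GARK scheme with Butcher tableau $$\begin{array}{cc}\mathbf A_{\mathrm{GARK}}&\mathbf 0_{s\times s}\\ \mathbf 1_{s\times1}\,\underline{\mathbf b}_{\mathrm{GARK}}^{\top}&\underline{\mathbf A}_{\mathrm{GARK}}\\ \hline \mathbf b_{\mathrm{GARK}}^{\top}&\underline{\mathbf b}_{\mathrm{GARK}}^{\top}\end{array}$$ and it is both symmetric and symplectic.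
   Context: GARK scheme. Real coefficients $\mathbf A^{\{q,m\}}=(a_{i,j}^{\{q,m\}})\in\mathbb R^{s^{\{q\}}\times s^{\{m\}}}$, $\mathbf b^{\{m\}}\in\mathbb R^{s^{\{m\}}}$, $q,m=1,\dots,N$; $s=\sum_m s^{\{m\}}$. Applied to $\mathbf y'=\sum_m\mathbf f^{\{m\}}(\mathbf y)$ with step size $h$: $$Y_i^{\{q\}}=\mathbf y_0+h\sum_{m=1}^{N}\sum_{j=1}^{s^{\{m\}}}a_{i,j}^{\{q,m\}}\mathbf f^{\{m\}}(Y_j^{\{m\}}),\qquad \mathbf y_1=\mathbf y_0+h\sum_{q=1}^{N}\sum_{i=1}^{s^{\{q\}}}b_i^{\{q\}}\mathbf f^{\{q\}}(Y_i^{\{q\}}).$$ $\mathbf A_{\mathrm{GARK}}=[\mathbf A^{\{q,m\}}]_{q,m}\in\mathbb R^{s\times s}$ and $\mathbf b_{\mathrm{GARK}}=[\mathbf b^{\{1\}\top},\dots,\mathbf b^{\{N\}\top}]^\top\in\mathbb R^{s}$ denote the assembled tableau. Time reversal. $\mathcal P^{\{m\}}\in\mathbb R^{s^{\{m\}}\times s^{\{m\}}}$ is the permutation matrix reversing the order of the entries of a vector, $\mathcal P=\operatorname{blkdiag}(\mathcal P^{\{1\}},\dots,\mathcal P^{\{N\}})$. The time-reversed scheme has coefficients $\underline{\mathbf b}^{\{m\}}=\mathcal P^{\{m\}}\mathbf b^{\{m\}}$, $\underline{\mathbf A}^{\{\ell,m\}}=\mathbf 1^{\{\ell\}}\mathbf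 b^{\{m\}\top}-\mathcal P^{\{\ell\}}\mathbf A^{\{\ell,m\}}\mathcal P^{\{m\}}$ ($\mathbf 1^{\{\ell\}}\in\mathbb R^{s^{\{\ell\}}}$ the vector of ones), i.e. $\underline{\mathbf b}_{\mathrm{GARK}}=\mathcal P\mathbf b_{\mathrm{GARK}}$, $\underline{\mathbf A}_{\mathrm{GARK}}=\mathbf 1_{s\times1}\mathbf b_{\mathrm{GARK}}^\top-\mathcal P\mathbf A_{\mathrm{GARK}}\mathcal P$. Symmetric. A GARK scheme is symmetric if it equals its time-reversed scheme: $\mathbf b^{\{m\}}=\underline{\mathbf b}^{\{m\}}$ and $\mathbf A^{\{\ell,m\}}=\underline{\mathbf A}^{\{\ell,m\}}$ for all $\ell,m$. Symplectic. A GARK scheme is symplectic if $(\mathbf A^{\{\ell,m\}})^{\top}\operatorname{diag}(\mathbf b^{\{\ell\}})+\operatorname{diag}(\mathbf b^{\{m\}})\mathbf A^{\{m,\ell\}}=\mathbf b^{\{m\}}(\mathbf b^{\{\ell\}})^{\top}$ for all $\ell,m$. Reading of the composed tableau. It is regarded as a GARK scheme with the same $N$ partitions, partition $m$ having $2s^{\{m\}}$ stages: first its $s^{\{m\}}$ stages from the first step, then its $s^{\{m\}}$ stages from the second step; so its blocks are $\begin{bmatrix}\mathbf A^{\{\ell,m\}}&\mathbf 0\\ \mathbf 1^{\{\ell\}}\underline{\mathbf b}^{\{m\}\top}&\underline{\mathbf A}^{\{\ell,m\}}\end{bmatrix}$ and its weights $\begin{bmatrix}\mathbf b^{\{m\}}\\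 \underline{\mathbf b}^{\{m\}}\end{bmatrix}$. With parameter $h$ it performs two steps of size $h$ (the tableau is not rescaled). *)

theory Defs
  imports "Jordan_Normal_Form.Matrix" "HOL-Analysis.Euclidean_Space"
begin

text \<open>
  Partitions are numbered \<open>1, \<dots>, N\<close> as in the literature; stages are numbered from \<open>0\<close>, as are
  the entries of library vectors and matrices. Values of the fields at indices outside
  \<open>{1..N}\<close> are meaningless, so schemes are never compared by equality of records.
\<close>

record gark =
  gark_N :: nat
  gark_s :: "nat \<Rightarrow> nat"
  gark_A :: "nat \<Rightarrow> nat \<Rightarrow> real mat"
  gark_b :: "nat \<Rightarrow> real vec"

definition gark_scheme :: "gark \<Rightarrow> bool" where
  "gark_scheme G \<longleftrightarrow>
     (\<forall>m\<in>{1..gark_N G}. gark_b G m \<in> carrier_vec (gark_s G m)) \<and>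
     (\<forall>q\<in>{1..gark_N G}. \<forall>m\<in>{1..gark_N G}.
        gark_A G q m \<in> carrier_mat (gark_s G q) (gark_s G m))"

text \<open>
  \<open>Y m i\<close> is the value of stage \<open>i\<close> of partition \<open>m\<close>. The schemes may be implicit, so a step is
  a relation between the initial value, the stage values and the final value.
\<close>

definition gark_step_with_stages ::
  "gark \<Rightarrow> (nat \<Rightarrow> 'v \<Rightarrow> 'v) \<Rightarrow> real \<Rightarrow> 'v \<Rightarrow> (nat \<Rightarrow> nat \<Rightarrow> 'v) \<Rightarrow> 'v::euclidean_space \<Rightarrow> bool" where
  "gark_step_with_stages G f h y\<^sub>0 Y y\<^sub>1 \<longleftrightarrow>
     (\<forall>q\<in>{1..gark_N G}. \<forall>i<gark_s G q.
        Y q i = y\<^sub>0 + h *\<^sub>R (\<Sum>m\<in>{1..gark_N G}. \<Sum>j<gark_s G m.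
                              (gark_A G q m $$ (i, j)) *\<^sub>R f m (Y m j))) \<and>
     y\<^sub>1 = y\<^sub>0 + h *\<^sub>R (\<Sum>q\<in>{1..gark_N G}. \<Sum>i<gark_s G q.
                        (gark_b G q $ i) *\<^sub>R f q (Y q i))"

definition gark_step ::
  "gark \<Rightarrow> (nat \<Rightarrow> 'v \<Rightarrow> 'v) \<Rightarrow> real \<Rightarrow> 'v \<Rightarrow> 'v::euclidean_space \<Rightarrow> bool" where
  "gark_step G f h y\<^sub>0 y\<^sub>1 \<longleftrightarrow> (\<exists>Y. gark_step_with_stages G f h y\<^sub>0 Y y\<^sub>1)"

definition outer_prod :: "real vec \<Rightarrow> real vec \<Rightarrow> real mat" where
  "outer_prod u v = mat (dim_vec u) (dim_vec v) (\<lambda>(i, j). u $ i * v $ j)"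

definition diag_of_vec :: "real vec \<Rightarrow> real mat" where
  "diag_of_vec v = mat_diag (dim_vec v) (\<lambda>i. v $ i)"

definition ones_vec :: "nat \<Rightarrow> real vec" where
  "ones_vec n = vec n (\<lambda>_. 1)"

definition reversal_mat :: "nat \<Rightarrow> real mat" where
  "reversal_mat n = mat n n (\<lambda>(i, j). if i + j + 1 = n then 1 else 0)"

definition time_reversed :: "gark \<Rightarrow> gark" where
  "time_reversed G =
     \<lparr> gark_N = gark_N G,
       gark_s = gark_s G,
       gark_A = (\<lambda>l m. outer_prod (ones_vec (gark_s G l)) (gark_b G m)
                   - reversal_mat (gark_s G l) * gark_A G l m * reversal_mat (gark_s G m)),
       gark_b = (\<lambda>m. reversal_mat (gark_s G m) *\<^sub>v gark_b G m) \<rparr>"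

definition gark_symmetric :: "gark \<Rightarrow> bool" where
  "gark_symmetric G \<longleftrightarrow>
     (\<forall>m\<in>{1..gark_N G}. gark_b G m = gark_b (time_reversed G) m) \<and>
     (\<forall>l\<in>{1..gark_N G}. \<forall>m\<in>{1..gark_N G}. gark_A G l m = gark_A (time_reversed G) l m)"

definition gark_symplectic :: "gark \<Rightarrow> bool" where
  "gark_symplectic G \<longleftrightarrow>
     (\<forall>l\<in>{1..gark_N G}. \<forall>m\<in>{1..gark_N G}.
        transpose_mat (gark_A G l m) * diag_of_vec (gark_b G l)
          + diag_of_vec (gark_b G m) * gark_A G m l
        = outer_prod (gark_b G m) (gark_b G l))"

definition palindromic_weights :: "gark \<Rightarrow> bool" where
  "palindromic_weights G \<longleftrightarrow>
     (\<forall>m\<in>{1..gark_N G}. gark_b G m = reversal_mat (gark_s G m) *\<^sub>v gark_b G m)"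

text \<open>
  The tableau with \<open>A\<close> and the reversed \<open>A\<close> on the diagonal and \<open>1 b\<^sup>T\<close> (with reversed \<open>b\<close>) below it,
  read as a scheme with the same partitions: partition \<open>m\<close> has its stages of the first step,
  then those of the second. It is not rescaled: with parameter \<open>h\<close> it advances by \<open>2h\<close>.
\<close>

definition composed_with_reversed :: "gark \<Rightarrow> gark" where
  "composed_with_reversed G =
     \<lparr> gark_N = gark_N G,
       gark_s = (\<lambda>m. 2 * gark_s G m),
       gark_A = (\<lambda>l m. four_block_mat
                   (gark_A G l m)
                   (0\<^sub>m (gark_s G l) (gark_s G m))
                   (outer_prod (ones_vec (gark_s G l)) (gark_b (time_reversed G) m))
                   (gark_A (time_reversed G) l m)),
       gark_b = (\<lambda>m. gark_b G m @\<^sub>v gark_b (time_reversed G) m) \<rparr>"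

definition concat_stages ::
  "gark \<Rightarrow> (nat \<Rightarrow> nat \<Rightarrow> 'v) \<Rightarrow> (nat \<Rightarrow> nat \<Rightarrow> 'v) \<Rightarrow> nat \<Rightarrow> nat \<Rightarrow> 'v" where
  "concat_stages G Y Y' m i = (if i < gark_s G m then Y m i else Y' m (i - gark_s G m))"

end

theory Submission
  imports Defs
begin

text \<open>
  Reversal of a partition of the composed scheme exchanges its two
  halves and reverses each of them, so each of the four quadrants of the symmetry and symplecticity
  conditions becomes an identity for the original coefficients. Palindromic weights identify the
  weights of the reversed scheme with the original ones; this also makes the lower left block
  reproduce the result of the first step.
\<close>

section \<open>Entries of products with reversal matrices\<close>

lemma dim_reversal_mat [simp]:
  "dim_row (reversal_mat n) = n" "dim_col (reversal_mat n) = n"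
  by (simp_all add: reversal_mat_def)

text \<open>Solving the condition of the definition for the column leaves at most one nonzero
  summand visible in a matrix product, so the sum collapses.\<close>

lemma index_reversal_mat:
  assumes "i < n" "j < n"
  shows "reversal_mat n $$ (i, j) = (if j = n - 1 - i then 1 else 0)"
  using assms by (auto simp: reversal_mat_def)

lemma index_reversal_mult_vec:
  assumes "v \<in> carrier_vec n" "i < n"
  shows "(reversal_mat n *\<^sub>v v) $ i = v $ (n - 1 - i)"
proof -
  have "(reversal_mat n *\<^sub>v v) $ i = (\<Sum>j<n. (if j = n - 1 - i then 1 else 0) * v $ j)"
    using assms by (auto simp: scalar_prod_def atLeast0LessThan index_reversal_mat intro!: sum.cong)
  also have "\<dots> = (\<Sum>j<n. if j = n - 1 - i then v $ j else 0)"
    by (intro sum.cong) auto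
  also have "\<dots> = v $ (n - 1 - i)"
    using assms by simp
  finally show ?thesis .
qed

lemma index_reversal_mult_mat:
  assumes "M \<in> carrier_mat n k" "i < n" "j < k"
  shows "(reversal_mat n * M) $$ (i, j) = M $$ (n - 1 - i, j)"
proof -
  have "(reversal_mat n * M) $$ (i, j) = (reversal_mat n *\<^sub>v col M j) $ i"
    using assms by simp
  also have "\<dots> = M $$ (n - 1 - i, j)"
    using assms by (subst index_reversal_mult_vec) auto
  finally show ?thesis .
qed

lemma index_mult_reversal_mat:
  assumes "M \<in> carrier_mat n k" "i < n" "j < k"
  shows "(M * reversal_mat k) $$ (i, j) = M $$ (i, k - 1 - j)"
proof -
  have "(M * reversal_mat k) $$ (i, j) = (\<Sum>r<k. M $$ (i, r) * (if j = k - 1 - r then 1 else 0))"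
    using assms by (auto simp: scalar_prod_def atLeast0LessThan index_reversal_mat intro!: sum.cong)
  \<comment> \<open>The condition is solved for the summation index; as \<open>r\<close> and
    \<open>j\<close> are both below \<open>k\<close>, truncated subtraction does no harm.\<close>
  also have "\<dots> = (\<Sum>r<k. if r = k - 1 - j then M $$ (i, r) else 0)"
    using assms by (intro sum.cong) auto
  also have "\<dots> = M $$ (i, k - 1 - j)"
    using assms by simp
  finally show ?thesis .
qed

lemma dim_outer_prod [simp]:
  "dim_row (outer_prod u v) = dim_vec u" "dim_col (outer_prod u v) = dim_vec v"
  by (simp_all add: outer_prod_def)

lemma index_outer_prod [simp]:
  "i < dim_vec u \<Longrightarrow> j < dim_vec v \<Longrightarrow> outer_prod u v $$ (i, j) = u $ i * v $ j"
  by (simp add: outer_prod_def)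

lemma dim_ones_vec [simp]: "dim_vec (ones_vec n) = n"
  by (simp add: ones_vec_def)

lemma index_ones_vec [simp]: "i < n \<Longrightarrow> ones_vec n $ i = 1"
  by (simp add: ones_vec_def)

section \<open>The time-reversed scheme, entry by entry\<close>

lemma gark_scheme_weights:
  "gark_scheme G \<Longrightarrow> m \<in> {1..gark_N G} \<Longrightarrow> gark_b G m \<in> carrier_vec (gark_s G m)"
  by (simp add: gark_scheme_def)

lemma gark_scheme_coeffs:
  "gark_scheme G \<Longrightarrow> l \<in> {1..gark_N G} \<Longrightarrow> m \<in> {1..gark_N G} \<Longrightarrow>
    gark_A G l m \<in> carrier_mat (gark_s G l) (gark_s G m)"
  by (simp add: gark_scheme_def)

lemma time_reversed_N [simp]: "gark_N (time_reversed G) = gark_N G"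
  and time_reversed_s [simp]: "gark_s (time_reversed G) = gark_s G"
  and composed_N [simp]: "gark_N (composed_with_reversed G) = gark_N G"
  and composed_s [simp]: "gark_s (composed_with_reversed G) m = 2 * gark_s G m"
  by (simp_all add: time_reversed_def composed_with_reversed_def)

lemma gark_scheme_time_reversed:
  assumes "gark_scheme G"
  shows "gark_scheme (time_reversed G)"
  unfolding gark_scheme_def
proof (intro conjI ballI)
  fix m assume "m \<in> {1..gark_N (time_reversed G)}"
  show "gark_b (time_reversed G) m \<in> carrier_vec (gark_s (time_reversed G) m)"
    by (rule carrier_vecI) (simp add: time_reversed_def)
  fix l assume "l \<in> {1..gark_N (time_reversed G)}"
  show "gark_A (time_reversed G) l m \<in> carrier_mat (gark_s (time_reversed G) l) (gark_s (time_reversed G) m)"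
    by (rule carrier_matI) (simp_all add: time_reversed_def)
qed

lemma time_reversed_weights_index:
  assumes "gark_scheme G" "m \<in> {1..gark_N G}" "i < gark_s G m"
  shows "gark_b (time_reversed G) m $ i = gark_b G m $ (gark_s G m - 1 - i)"
  using assms gark_scheme_weights[OF assms(1,2)]
  \<comment> \<open>The deleted rule would turn the product into a scalar product before the
    reversal rule could apply.\<close>
  by (simp add: time_reversed_def index_reversal_mult_vec del: index_mult_mat_vec)

lemma time_reversed_coeffs_index:
  assumes "gark_scheme G" "l \<in> {1..gark_N G}" "m \<in> {1..gark_N G}"
    and "i < gark_s G l" "j < gark_s G m"
  shows "gark_A (time_reversed G) l m $$ (i, j) =
    gark_b G m $ j - gark_A G l m $$ (gark_s G l - 1 - i, gark_s G m - 1 - j)"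
proof -
  note b = gark_scheme_weights[OF assms(1,3)] and A = gark_scheme_coeffs[OF assms(1-3)]
  have RA: "reversal_mat (gark_s G l) * gark_A G l m \<in> carrier_mat (gark_s G l) (gark_s G m)"
    using A by auto
  have "(reversal_mat (gark_s G l) * gark_A G l m * reversal_mat (gark_s G m)) $$ (i, j) =
      gark_A G l m $$ (gark_s G l - 1 - i, gark_s G m - 1 - j)"
    using assms(4,5) A
    by (simp add: index_mult_reversal_mat[OF RA] index_reversal_mult_mat del: index_mult_mat(1))
  then show ?thesis
    using assms(4,5) b A by (simp add: time_reversed_def del: index_mult_mat(1))
qed

lemma palindromic_weights_time_reversed:
  assumes "palindromic_weights G" "m \<in> {1..gark_N G}"
  shows "gark_b (time_reversed G) m = gark_b G m"
  using assms unfolding palindromic_weights_def time_reversed_def by simp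

lemma palindromic_weights_index:
  assumes "gark_scheme G" "palindromic_weights G" "m \<in> {1..gark_N G}" "i < gark_s G m"
  shows "gark_b G m $ (gark_s G m - 1 - i) = gark_b G m $ i"
  using time_reversed_weights_index[OF assms(1,3,4)] palindromic_weights_time_reversed[OF assms(2,3)]
  by simp

section \<open>Symmetry and symplecticity as conditions on entries\<close>

lemma gark_symmetric_iff_index:
  assumes "gark_scheme G"
  shows "gark_symmetric G \<longleftrightarrow>
    (\<forall>m\<in>{1..gark_N G}. \<forall>i<gark_s G m. gark_b G m $ i = gark_b G m $ (gark_s G m - 1 - i)) \<and>
    (\<forall>l\<in>{1..gark_N G}. \<forall>m\<in>{1..gark_N G}. \<forall>i<gark_s G l. \<forall>j<gark_s G m.
      gark_A G l m $$ (i, j) =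
      gark_b G m $ j - gark_A G l m $$ (gark_s G l - 1 - i, gark_s G m - 1 - j))"
proof -
  note R = gark_scheme_time_reversed[OF assms]
  have b: "gark_b G m = gark_b (time_reversed G) m \<longleftrightarrow>
      (\<forall>i<gark_s G m. gark_b G m $ i = gark_b G m $ (gark_s G m - 1 - i))"
    if "m \<in> {1..gark_N G}" for m
    using gark_scheme_weights[OF assms that] gark_scheme_weights[OF R, of m] that
      time_reversed_weights_index[OF assms that]
    by (simp add: vec_eq_iff)
  have A: "gark_A G l m = gark_A (time_reversed G) l m \<longleftrightarrow>
      (\<forall>i<gark_s G l. \<forall>j<gark_s G m. gark_A G l m $$ (i, j) =
        gark_b G m $ j - gark_A G l m $$ (gark_s G l - 1 - i, gark_s G m - 1 - j))"
    if "l \<in> {1..gark_N G}" "m \<in> {1..gark_N G}" for l m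
    using gark_scheme_coeffs[OF assms that] gark_scheme_coeffs[OF R, of l m] that
      time_reversed_coeffs_index[OF assms that]
    by (simp add: mat_eq_iff)
  show ?thesis
    unfolding gark_symmetric_def using b A by (intro arg_cong2[of _ _ _ _ "(\<and>)"] ball_cong) auto
qed

text \<open>A diagonal factor on the right scales columns, one on the left scales rows. Here
  \<open>i\<close> is a stage of partition \<open>m\<close> and \<open>j\<close> one of partition
  \<open>l\<close>.\<close>

lemma gark_symplectic_iff_index:
  assumes "gark_scheme G"
  shows "gark_symplectic G \<longleftrightarrow>
    (\<forall>l\<in>{1..gark_N G}. \<forall>m\<in>{1..gark_N G}. \<forall>i<gark_s G m. \<forall>j<gark_s G l.
      gark_A G l m $$ (j, i) * gark_b G l $ j + gark_b G m $ i * gark_A G m l $$ (i, j) =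
      gark_b G m $ i * gark_b G l $ j)"
proof -
  have "transpose_mat (gark_A G l m) * diag_of_vec (gark_b G l)
          + diag_of_vec (gark_b G m) * gark_A G m l = outer_prod (gark_b G m) (gark_b G l) \<longleftrightarrow>
      (\<forall>i<gark_s G m. \<forall>j<gark_s G l.
        gark_A G l m $$ (j, i) * gark_b G l $ j + gark_b G m $ i * gark_A G m l $$ (i, j) =
        gark_b G m $ i * gark_b G l $ j)"
    if l: "l \<in> {1..gark_N G}" and m: "m \<in> {1..gark_N G}" for l m
  proof -
    note bl = gark_scheme_weights[OF assms l] and bm = gark_scheme_weights[OF assms m]
      and Alm = gark_scheme_coeffs[OF assms l m] and Aml = gark_scheme_coeffs[OF assms m l]
    have T: "transpose_mat (gark_A G l m) * diag_of_vec (gark_b G l) =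
        mat (gark_s G m) (gark_s G l) (\<lambda>(i, j). gark_A G l m $$ (j, i) * gark_b G l $ j)"
      using bl Alm unfolding diag_of_vec_def
      by (subst mat_diag_mult_right[of _ "gark_s G m"]) (auto intro!: eq_matI)
    have D: "diag_of_vec (gark_b G m) * gark_A G m l =
        mat (gark_s G m) (gark_s G l) (\<lambda>(i, j). gark_b G m $ i * gark_A G m l $$ (i, j))"
      using bm Aml unfolding diag_of_vec_def
      by (subst mat_diag_mult_left[of _ _ "gark_s G l"]) auto
    show ?thesis
      unfolding T D using bl bm by (simp add: mat_eq_iff)
  qed
  then show ?thesis
    unfolding gark_symplectic_def by (intro ball_cong refl)
qed

section \<open>Entries of the composed tableau\<close>

lemma composed_weights_index:
  assumes "gark_scheme G" "palindromic_weights G" "m \<in> {1..gark_N G}"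
    and "i < 2 * gark_s G m"
  shows "gark_b (composed_with_reversed G) m $ i =
    gark_b G m $ (if i < gark_s G m then i else i - gark_s G m)"
  using gark_scheme_weights[OF assms(1,3)] assms(4) palindromic_weights_time_reversed[OF assms(2,3)]
  by (simp add: composed_with_reversed_def)

text \<open>Reflection of the doubled index range swaps the halves and reverses each; the halves are
  equal copies, and palindromicity absorbs the reversal.\<close>

lemma composed_weights_reflect:
  assumes "gark_scheme G" "palindromic_weights G" "m \<in> {1..gark_N G}"
    and "i < 2 * gark_s G m"
  shows "gark_b (composed_with_reversed G) m $ (2 * gark_s G m - 1 - i) =
    gark_b (composed_with_reversed G) m $ i"
proof (cases "i < gark_s G m")
  case True
  then have "2 * gark_s G m - 1 - i - gark_s G m = gark_s G m - 1 - i"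
    "\<not> 2 * gark_s G m - 1 - i < gark_s G m" by simp_all
  with True show ?thesis
    using palindromic_weights_index[OF assms(1-3) True]
    by (simp add: composed_weights_index[OF assms(1-3)])
next
  case False
  then have "2 * gark_s G m - 1 - i = gark_s G m - 1 - (i - gark_s G m)" "i - gark_s G m < gark_s G m"
    using assms(4) by simp_all
  with False assms(4) show ?thesis
    using palindromic_weights_index[OF assms(1-3), of "i - gark_s G m"]
    by (simp add: composed_weights_index[OF assms(1-3)])
qed

text \<open>The lower rows are written as the weights minus the upper rows rotated by 180 degrees:
  the 0 subtracted in the lower left block is the rotated zero block. Reflecting in the full range
  of length \<open>2 * gark_s G l\<close> or \<open>2 * gark_s G m\<close> makes this the pattern of
  symmetry.\<close>

lemma composed_coeffs_index:
  assumes "gark_scheme G" "palindromic_weights G" "l \<in> {1..gark_N G}" "m \<in> {1..gark_N G}"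
    and "i < 2 * gark_s G l" "j < 2 * gark_s G m"
  shows "gark_A (composed_with_reversed G) l m $$ (i, j) =
    (if i < gark_s G l then if j < gark_s G m then gark_A G l m $$ (i, j) else 0
     else gark_b (composed_with_reversed G) m $ j -
       (if j < gark_s G m then 0
        else gark_A G l m $$ (2 * gark_s G l - 1 - i, 2 * gark_s G m - 1 - j)))"
proof -
  have "gark_A (time_reversed G) l m $$ (i - gark_s G l, j - gark_s G m) =
      gark_b G m $ (j - gark_s G m) - gark_A G l m $$ (2 * gark_s G l - 1 - i, 2 * gark_s G m - 1 - j)"
    if "\<not> i < gark_s G l" "\<not> j < gark_s G m"
  proof -
    \<comment> \<open>For an index in the second half, shifting it back and reversing within one
      block is the reflection of the full range.\<close>
    have "gark_s G l - 1 - (i - gark_s G l) = 2 * gark_s G l - 1 - i"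
      "gark_s G m - 1 - (j - gark_s G m) = 2 * gark_s G m - 1 - j"
      using that by simp_all
    then show ?thesis
      using that assms by (subst time_reversed_coeffs_index) auto
  qed
  then show ?thesis
    unfolding composed_weights_index[OF assms(1,2,4,6)]
    using gark_scheme_coeffs[OF assms(1,3,4)] gark_scheme_weights[OF assms(1,4)] assms(3-6)
      gark_scheme_coeffs[OF gark_scheme_time_reversed[OF assms(1)], of l m]
      palindromic_weights_time_reversed[OF assms(2,4)]
    by (auto simp: composed_with_reversed_def)
qed

lemma gark_scheme_composed:
  assumes "gark_scheme G"
  shows "gark_scheme (composed_with_reversed G)"
  unfolding gark_scheme_def
proof (intro conjI ballI)
  note R = gark_scheme_time_reversed[OF assms]
  fix m assume m: "m \<in> {1..gark_N (composed_with_reversed G)}"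
  then show "gark_b (composed_with_reversed G) m \<in> carrier_vec (gark_s (composed_with_reversed G) m)"
    using gark_scheme_weights[OF assms, of m] gark_scheme_weights[OF R, of m]
    by (intro carrier_vecI) (simp add: composed_with_reversed_def)
  fix l assume "l \<in> {1..gark_N (composed_with_reversed G)}"
  then show "gark_A (composed_with_reversed G) l m
      \<in> carrier_mat (gark_s (composed_with_reversed G) l) (gark_s (composed_with_reversed G) m)"
    using m gark_scheme_coeffs[OF assms, of l m] gark_scheme_coeffs[OF R, of l m]
    by (intro carrier_matI) (simp_all add: composed_with_reversed_def)
qed

section \<open>Symmetry and symplecticity of the composition\<close>

lemma gark_symmetric_composed:
  assumes "gark_scheme G" "palindromic_weights G"
  shows "gark_symmetric (composed_with_reversed G)"
  unfolding gark_symmetric_iff_index[OF gark_scheme_composed[OF assms(1)]] composed_N composed_s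
proof (intro conjI ballI allI impI)
  fix m i assume "m \<in> {1..gark_N G}" "i < 2 * gark_s G m"
  then show "gark_b (composed_with_reversed G) m $ i =
      gark_b (composed_with_reversed G) m $ (2 * gark_s G m - 1 - i)"
    by (rule composed_weights_reflect[OF assms, symmetric])
next
  fix l m i j
  assume l: "l \<in> {1..gark_N G}" and m: "m \<in> {1..gark_N G}"
    and i: "i < 2 * gark_s G l" and j: "j < 2 * gark_s G m"
  define i' j' where "i' = 2 * gark_s G l - 1 - i" and "j' = 2 * gark_s G m - 1 - j"
  \<comment> \<open>Reflection is an involution exchanging the halves, so the entry formula at
    \<open>(i', j')\<close> can be expressed by the case distinctions at
    \<open>(i, j)\<close>.\<close>
  have reflect: "i' < 2 * gark_s G l" "j' < 2 * gark_s G m"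
    "2 * gark_s G l - 1 - i' = i" "2 * gark_s G m - 1 - j' = j"
    "i' < gark_s G l \<longleftrightarrow> \<not> i < gark_s G l" "j' < gark_s G m \<longleftrightarrow> \<not> j < gark_s G m"
    using i j by (auto simp: i'_def j'_def)
  have "gark_b (composed_with_reversed G) m $ j' = gark_b (composed_with_reversed G) m $ j"
    unfolding j'_def by (rule composed_weights_reflect[OF assms m j])
  then show "gark_A (composed_with_reversed G) l m $$ (i, j) =
    gark_b (composed_with_reversed G) m $ j -
    gark_A (composed_with_reversed G) l m $$ (2 * gark_s G l - 1 - i, 2 * gark_s G m - 1 - j)"
    unfolding i'_def[symmetric] j'_def[symmetric] composed_coeffs_index[OF assms l m i j]
      composed_coeffs_index[OF assms l m reflect(1,2)] reflect(3-6)
    by simp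
qed

text \<open>In the two off-diagonal quadrants one term vanishes by the zero block and the other is
  already the product of weights. In the lower right one the two products of weights minus the
  original relation at reflected indices leave one product.\<close>

lemma gark_symplectic_composed:
  assumes "gark_scheme G" "palindromic_weights G" "gark_symplectic G"
  shows "gark_symplectic (composed_with_reversed G)"
  unfolding gark_symplectic_iff_index[OF gark_scheme_composed[OF assms(1)]] composed_N composed_s
proof (intro ballI allI impI)
  let ?w = "gark_b (composed_with_reversed G)"
  fix l m i j
  assume l: "l \<in> {1..gark_N G}" and m: "m \<in> {1..gark_N G}"
    and i: "i < 2 * gark_s G m" and j: "j < 2 * gark_s G l"
  define i' j' where "i' = 2 * gark_s G m - 1 - i" and "j' = 2 * gark_s G l - 1 - j"
  \<comment> \<open>Symplecticity of \<open>G\<close>, phrased with the composed weights, which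
    agree with the original ones on the first half.\<close>
  have first: "gark_A G l m $$ (q, p) * ?w l $ q + ?w m $ p * gark_A G m l $$ (p, q) = ?w m $ p * ?w l $ q"
    if "p < gark_s G m" "q < gark_s G l" for p q
    using assms(3) that l m
    by (simp add: gark_symplectic_iff_index[OF assms(1)] composed_weights_index[OF assms(1,2)])
  \<comment> \<open>The same relation at the reflected indices, which lie in the first half;
    reflection invariance moves the weights back to \<open>i\<close> and \<open>j\<close>.\<close>
  have second: "gark_A G l m $$ (j', i') * ?w l $ j + ?w m $ i * gark_A G m l $$ (i', j') = ?w m $ i * ?w l $ j"
    if "\<not> i < gark_s G m" "\<not> j < gark_s G l"
    using first[of i' j'] that i j composed_weights_reflect[OF assms(1,2) m i]
      composed_weights_reflect[OF assms(1,2) l j]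
    by (simp add: i'_def j'_def)
  show "gark_A (composed_with_reversed G) l m $$ (j, i) * ?w l $ j +
      ?w m $ i * gark_A (composed_with_reversed G) m l $$ (i, j) = ?w m $ i * ?w l $ j"
    unfolding composed_coeffs_index[OF assms(1,2) l m j i] composed_coeffs_index[OF assms(1,2) m l i j]
      i'_def[symmetric] j'_def[symmetric]
    using first[of i j] second by (auto simp: algebra_simps)
qed

section \<open>The composed scheme as two successive steps\<close>

lemma sum_lessThan_double:
  fixes g :: "nat \<Rightarrow> 'a::comm_monoid_add"
  shows "(\<Sum>j<2 * n. g j) = (\<Sum>j<n. g j) + (\<Sum>j<n. g (n + j))"
proof -
  \<comment> \<open>Unequal lengths allow induction on the second one alone.\<close>
  have "(\<Sum>j<n + k. g j) = (\<Sum>j<n. g j) + (\<Sum>j<k. g (n + j))" for k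
    by (induction k) (simp_all add: add.assoc)
  then show ?thesis by (simp add: mult_2)
qed

lemma all_less_double: "(\<forall>i<2 * n. P i) \<longleftrightarrow> (\<forall>i<n. P i) \<and> (\<forall>i<n. P (n + i))" for n :: nat
proof -
  have "P i" if "\<forall>i<n. P i" "\<forall>i<n. P (n + i)" "i < 2 * n" for i
    using that by (cases "i < n") (auto dest!: spec[of _ "i - n"])
  then show ?thesis by auto
qed

text \<open>The zero block decouples the first stages from the second ones, and the lower left block
  adds the whole increment of the first step to every second stage, so these start from its
  result.\<close>

lemma composed_step_with_stages:
  fixes f :: "nat \<Rightarrow> 'v::euclidean_space \<Rightarrow> 'v"
  assumes "gark_scheme G" "palindromic_weights G"
  shows "gark_step_with_stages (composed_with_reversed G) f h y\<^sub>0 (concat_stages G Y Y') y\<^sub>2 \<longleftrightarrow>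
    (\<exists>y\<^sub>1. gark_step_with_stages G f h y\<^sub>0 Y y\<^sub>1 \<and> gark_step_with_stages (time_reversed G) f h y\<^sub>1 Y' y\<^sub>2)"
proof -
  let ?C = "composed_with_reversed G" and ?T = "time_reversed G" and ?Z = "concat_stages G Y Y'"
  \<comment> \<open>The only possible intermediate value: the stages \<open>Y\<close> determine the
    result of the first step.\<close>
  define y\<^sub>1 where "y\<^sub>1 = y\<^sub>0 + h *\<^sub>R (\<Sum>m\<in>{1..gark_N G}. \<Sum>j<gark_s G m. (gark_b G m $ j) *\<^sub>R f m (Y m j))"
  note T = gark_scheme_time_reversed[OF assms(1)]
  have weights: "gark_b ?C m $ j = gark_b G m $ j" "gark_b ?C m $ (gark_s G m + j) = gark_b ?T m $ j"
    if "m \<in> {1..gark_N G}" "j < gark_s G m" for m j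
    using gark_scheme_weights[OF assms(1) that(1)] gark_scheme_weights[OF T, of m] that
    by (simp_all add: composed_with_reversed_def)
  \<comment> \<open>The tableau has reversed weights in the lower left block; palindromicity turns
    them into the weights of the first step.\<close>
  have coeffs: "gark_A ?C q m $$ (i, j) = gark_A G q m $$ (i, j)"
      "gark_A ?C q m $$ (i, gark_s G m + j) = 0"
      "gark_A ?C q m $$ (gark_s G q + i, j) = gark_b G m $ j"
      "gark_A ?C q m $$ (gark_s G q + i, gark_s G m + j) = gark_A ?T q m $$ (i, j)"
    if "q \<in> {1..gark_N G}" "m \<in> {1..gark_N G}" "i < gark_s G q" "j < gark_s G m" for q m i j
    using gark_scheme_coeffs[OF assms(1) that(1,2)] gark_scheme_coeffs[OF T, of q m] that
      gark_scheme_weights[OF assms(1) that(2)] palindromic_weights_time_reversed[OF assms(2) that(2)]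
    by (simp_all add: composed_with_reversed_def)
  have final: "(\<Sum>m\<in>{1..gark_N G}. \<Sum>j<2 * gark_s G m. (gark_b ?C m $ j) *\<^sub>R f m (?Z m j)) =
      (\<Sum>m\<in>{1..gark_N G}. \<Sum>j<gark_s G m. (gark_b G m $ j) *\<^sub>R f m (Y m j)) +
      (\<Sum>m\<in>{1..gark_N G}. \<Sum>j<gark_s G m. (gark_b ?T m $ j) *\<^sub>R f m (Y' m j))"
    by (simp add: sum_lessThan_double concat_stages_def weights sum.distrib)
  have stage1: "(\<Sum>m\<in>{1..gark_N G}. \<Sum>j<2 * gark_s G m. (gark_A ?C q m $$ (i, j)) *\<^sub>R f m (?Z m j)) =
      (\<Sum>m\<in>{1..gark_N G}. \<Sum>j<gark_s G m. (gark_A G q m $$ (i, j)) *\<^sub>R f m (Y m j))"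
    if "q \<in> {1..gark_N G}" "i < gark_s G q" for q i
    using that by (simp add: sum_lessThan_double concat_stages_def coeffs)
  have stage2: "(\<Sum>m\<in>{1..gark_N G}. \<Sum>j<2 * gark_s G m.
        (gark_A ?C q m $$ (gark_s G q + i, j)) *\<^sub>R f m (?Z m j)) =
      (\<Sum>m\<in>{1..gark_N G}. \<Sum>j<gark_s G m. (gark_b G m $ j) *\<^sub>R f m (Y m j)) +
      (\<Sum>m\<in>{1..gark_N G}. \<Sum>j<gark_s G m. (gark_A ?T q m $$ (i, j)) *\<^sub>R f m (Y' m j))"
    if "q \<in> {1..gark_N G}" "i < gark_s G q" for q i
    using that by (simp add: sum_lessThan_double concat_stages_def coeffs sum.distrib)
  have "gark_step_with_stages ?C f h y\<^sub>0 ?Z y\<^sub>2 \<longleftrightarrow>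
      (\<forall>q\<in>{1..gark_N G}. \<forall>i<gark_s G q. Y q i = y\<^sub>0 + h *\<^sub>R
        (\<Sum>m\<in>{1..gark_N G}. \<Sum>j<gark_s G m. (gark_A G q m $$ (i, j)) *\<^sub>R f m (Y m j))) \<and>
      gark_step_with_stages ?T f h y\<^sub>1 Y' y\<^sub>2"
    unfolding gark_step_with_stages_def composed_N composed_s time_reversed_N time_reversed_s
      all_less_double final y\<^sub>1_def
    using stage1 stage2 by (auto simp: concat_stages_def scaleR_add_right add.assoc)
  also have "\<dots> \<longleftrightarrow> (\<exists>y\<^sub>1. gark_step_with_stages G f h y\<^sub>0 Y y\<^sub>1 \<and> gark_step_with_stages ?T f h y\<^sub>1 Y' y\<^sub>2)"
    unfolding gark_step_with_stages_def[of G] y\<^sub>1_def by blast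
  finally show ?thesis .
qed

text \<open>Every family of stage values is a concatenation, even at indices out of range, so
  quantifying over concatenations loses nothing.\<close>

lemma concat_stages_split: "concat_stages G Z (\<lambda>m i. Z m (gark_s G m + i)) = Z"
  by (auto simp: concat_stages_def fun_eq_iff)

lemma composed_step:
  fixes f :: "nat \<Rightarrow> 'v::euclidean_space \<Rightarrow> 'v"
  assumes "gark_scheme G" "palindromic_weights G"
  shows "gark_step (composed_with_reversed G) f h y\<^sub>0 y\<^sub>2 \<longleftrightarrow>
    (\<exists>y\<^sub>1. gark_step G f h y\<^sub>0 y\<^sub>1 \<and> gark_step (time_reversed G) f h y\<^sub>1 y\<^sub>2)"
proof -
  have "gark_step (composed_with_reversed G) f h y\<^sub>0 y\<^sub>2 \<longleftrightarrow>
      (\<exists>Y Y'. gark_step_with_stages (composed_with_reversed G) f h y\<^sub>0 (concat_stages G Y Y') y\<^sub>2)"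
    unfolding gark_step_def by (metis concat_stages_split)
  also have "\<dots> \<longleftrightarrow> (\<exists>y\<^sub>1. gark_step G f h y\<^sub>0 y\<^sub>1 \<and> gark_step (time_reversed G) f h y\<^sub>1 y\<^sub>2)"
    unfolding composed_step_with_stages[OF assms] gark_step_def by blast
  finally show ?thesis .
qed

text \<open>The version with stages also records that the stages of the composed step are those of
  the two steps, in this order within each partition.\<close>

theorem theorem3p6:
  fixes G :: gark
  assumes "gark_scheme G"
    and "gark_symplectic G"
    and "palindromic_weights G"
  shows "gark_scheme (composed_with_reversed G) \<and>
    (\<forall>(f :: nat \<Rightarrow> 'v::euclidean_space \<Rightarrow> 'v) h y\<^sub>0 y\<^sub>2.
       gark_step (composed_with_reversed G) f h y\<^sub>0 y\<^sub>2 \<longleftrightarrow>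
       (\<exists>y\<^sub>1. gark_step G f h y\<^sub>0 y\<^sub>1 \<and> gark_step (time_reversed G) f h y\<^sub>1 y\<^sub>2)) \<and>
    (\<forall>(f :: nat \<Rightarrow> 'v \<Rightarrow> 'v) h y\<^sub>0 Y Y' y\<^sub>2.
       gark_step_with_stages (composed_with_reversed G) f h y\<^sub>0 (concat_stages G Y Y') y\<^sub>2 \<longleftrightarrow>
       (\<exists>y\<^sub>1. gark_step_with_stages G f h y\<^sub>0 Y y\<^sub>1 \<and>
             gark_step_with_stages (time_reversed G) f h y\<^sub>1 Y' y\<^sub>2)) \<and>
    gark_symmetric (composed_with_reversed G) \<and>
    gark_symplectic (composed_with_reversed G)"
  using assms
  by (intro conjI allI gark_scheme_composed composed_step composed_step_with_stages
      gark_symmetric_composed gark_symplectic_composed)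

end
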